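(* Let $\sigma>0$, $k>0$, $n\ge1$, and let $P=\mathcal N(0,\sigma^2)$. For levels $y_1<\dots<y_n$ and thresholds $\zeta_1<\dots<\zeta_{n-1}$ let $I_i=(\zeta_{i-1},\zeta_i]$ (with $\zeta_0=-\infty$, $\zeta_n=+\infty$), $w_i=P(I_i)$, $\bar x_i=w_i^{-1}\int_{I_i}x\,dP$, and $Q_n=\sum_iw_i\delta_{y_i}$. Let $(y,\zeta)$ be an interior stationary point (with all $w_i>0$) of $$J(y,\zeta)=k^2\sum_{j=1}^n\int_{\zeta_{j-1}}^{\zeta_j}(x-y_j)^2\,dP+\operatorname{mmse}(Q_n).$$ Let $\Psi(y)=y^2-2y\,a(y)+b(y)$, with $a(y)=\int m(z)\phi(z-y)\,dz$, $b(y)=\int m(z)^2\phi(z-y)\,dz$ and $m(z)=\mathbb E[Y\mid Y+N=z]$ for independent $Y\sim Q_n$, $N\sim\mathcal N(0,1)$. Then $$2k^2w_i(y_i-\bar x_i)+\partial_{y_i}\operatorname{mmse}(Q_n)=0\qquad(i=1,\dots,n),$$ $$\zeta_i=\frac{y_i+y_{i+1}}2+\frac{\Psi(y_{i+1})-\Psi(y_i)}{2k^2(y_{i+1}-y_i)}\qquad(i=1,\dots,n-1).$$ That is, $\zeta_i$ is the midpoint (nearest-neighbour, or Voronoi, boundary) of the two adjacent levels displaced by a correction term, which vanishes as $k\to\infty$.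
   Context: $\phi$ is the standard normal density. $\operatorname{mmse}(Q)=\mathbb E[\operatorname{Var}(Y\mid Y+N)]$ for independent $Y\sim Q$, $N\sim\mathcal N(0,1)$. The partial derivative $\partial_{y_i}\operatorname{mmse}(Q_n)$ is taken with the weights $w$ fixed. The function $J(y,\zeta)$ equals $k^2W_2^2(P,Q_n)+\operatorname{mmse}(Q_n)$. *)

theory Defs
  imports "HOL-Probability.Probability"
begin

definition gauss :: "real \<Rightarrow> real measure" where
  "gauss \<sigma> = density lborel (\<lambda>x. ennreal (normal_density 0 \<sigma> x))"

text \<open>The canonical space carrying independent \<open>Y \<sim> Q\<close> and \<open>N \<sim> N(0, 1)\<close>:
  \<open>Y\<close> is \<^const>\<open>fst\<close> and \<open>N\<close> is \<^const>\<open>snd\<close>.\<close>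

definition chan :: "real measure \<Rightarrow> (real \<times> real) measure" where
  "chan Q = Q \<Otimes>\<^sub>M gauss 1"

definition chan_obs :: "real measure \<Rightarrow> (real \<times> real) measure" where
  "chan_obs Q = vimage_algebra (space (chan Q)) (\<lambda>\<omega>. fst \<omega> + snd \<omega>) borel"

definition cond_mean :: "real measure \<Rightarrow> real \<times> real \<Rightarrow> real" where
  "cond_mean Q = real_cond_exp (chan Q) (chan_obs Q) fst"

definition cond_var :: "real measure \<Rightarrow> real \<times> real \<Rightarrow> real" where
  "cond_var Q = real_cond_exp (chan Q) (chan_obs Q) (\<lambda>\<omega>. (fst \<omega> - cond_mean Q \<omega>)\<^sup>2)"

definition mmse :: "real measure \<Rightarrow> real" where
  "mmse Q = (\<integral>\<omega>. cond_var Q \<omega> \<partial>chan Q)"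

text \<open>\<open>m(z) = E[Y | Y + N = z]\<close> is determined only up to null sets of the law of \<open>Y + N\<close>,
  that is (this law having a positive density) up to Lebesgue null sets; so it is rendered as the
  predicate of being a version of it.\<close>

definition is_regression :: "real measure \<Rightarrow> (real \<Rightarrow> real) \<Rightarrow> bool" where
  "is_regression Q m \<longleftrightarrow> m \<in> borel_measurable borel \<and>
     (AE \<omega> in chan Q. cond_mean Q \<omega> = m (fst \<omega> + snd \<omega>))"

definition a_fun :: "(real \<Rightarrow> real) \<Rightarrow> real \<Rightarrow> real" where
  "a_fun m y = (\<integral>z. m z * std_normal_density (z - y) \<partial>lborel)"

definition b_fun :: "(real \<Rightarrow> real) \<Rightarrow> real \<Rightarrow> real" where
  "b_fun m y = (\<integral>z. (m z)\<^sup>2 * std_normal_density (z - y) \<partial>lborel)"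

definition Psi :: "(real \<Rightarrow> real) \<Rightarrow> real \<Rightarrow> real" where
  "Psi m y = y\<^sup>2 - 2 * y * a_fun m y + b_fun m y"

text \<open>Levels \<open>y\<close> and thresholds \<open>\<zeta>\<close> are functions on \<^typ>\<open>nat\<close> of which only the values
  \<open>y 1, \<dots>, y n\<close> and \<open>\<zeta> 1, \<dots>, \<zeta> (n - 1)\<close> are used.\<close>

definition ext_threshold :: "nat \<Rightarrow> (nat \<Rightarrow> real) \<Rightarrow> nat \<Rightarrow> ereal" where
  "ext_threshold n \<zeta> i = (if i = 0 then -\<infinity> else if i < n then ereal (\<zeta> i) else \<infinity>)"

definition cell :: "nat \<Rightarrow> (nat \<Rightarrow> real) \<Rightarrow> nat \<Rightarrow> real set" where
  "cell n \<zeta> i = {x. ext_threshold n \<zeta> (i - 1) < ereal x \<and> ereal x \<le> ext_threshold n \<zeta> i}"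

definition weight :: "real \<Rightarrow> nat \<Rightarrow> (nat \<Rightarrow> real) \<Rightarrow> nat \<Rightarrow> real" where
  "weight \<sigma> n \<zeta> i = measure (gauss \<sigma>) (cell n \<zeta> i)"

definition centroid :: "real \<Rightarrow> nat \<Rightarrow> (nat \<Rightarrow> real) \<Rightarrow> nat \<Rightarrow> real" where
  "centroid \<sigma> n \<zeta> i = inverse (weight \<sigma> n \<zeta> i) * (\<integral>x\<in>cell n \<zeta> i. x \<partial>gauss \<sigma>)"

text \<open>The discrete measure with mass \<open>w i\<close> at \<open>y i\<close>, as a push-forward from the index set.\<close>

definition discr :: "nat \<Rightarrow> (nat \<Rightarrow> real) \<Rightarrow> (nat \<Rightarrow> real) \<Rightarrow> real measure" where
  "discr n w y = distr (point_measure {1..n} (\<lambda>i. ennreal (w i))) borel y"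

lemma emeasure_discr:
  assumes "A \<in> sets borel"
  shows "emeasure (discr n w y) A = (\<Sum>i\<in>{1..n}. ennreal (w i) * indicator A (y i))"
proof -
  have "emeasure (discr n w y) A
      = emeasure (point_measure {1..n} (\<lambda>i. ennreal (w i))) (y -` A \<inter> {1..n})"
    unfolding discr_def using assms by (subst emeasure_distr) (auto simp: space_point_measure)
  also have "\<dots> = (\<Sum>i\<in>y -` A \<inter> {1..n}. ennreal (w i))"
    by (rule emeasure_point_measure_finite) auto
  also have "\<dots> = (\<Sum>i\<in>{1..n}. ennreal (w i) * indicator A (y i))"
    by (rule sum.mono_neutral_cong_left) (auto simp: indicator_def)
  finally show ?thesis .
qed

definition J :: "real \<Rightarrow> real \<Rightarrow> nat \<Rightarrow> (nat \<Rightarrow> real) \<Rightarrow> (nat \<Rightarrow> real) \<Rightarrow> real" where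
  "J k \<sigma> n y \<zeta> =
     k\<^sup>2 * (\<Sum>j\<in>{1..n}. \<integral>x\<in>cell n \<zeta> j. (x - y j)\<^sup>2 \<partial>gauss \<sigma>) + mmse (discr n (weight \<sigma> n \<zeta>) y)"

definition ordered :: "nat \<Rightarrow> (nat \<Rightarrow> real) \<Rightarrow> (nat \<Rightarrow> real) \<Rightarrow> bool" where
  "ordered n y \<zeta> \<longleftrightarrow> strict_mono_on {1..n} y \<and> strict_mono_on {1..<n} \<zeta>"

text \<open>A point of the open domain of ordered configurations with positive weights at which all
  \<open>2 n - 1\<close> partial derivatives of \<^const>\<open>J\<close> exist and vanish.\<close>

definition interior_stationary ::
    "real \<Rightarrow> real \<Rightarrow> nat \<Rightarrow> (nat \<Rightarrow> real) \<Rightarrow> (nat \<Rightarrow> real) \<Rightarrow> bool" where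
  "interior_stationary k \<sigma> n y \<zeta> \<longleftrightarrow>
     ordered n y \<zeta> \<and> (\<forall>i\<in>{1..n}. weight \<sigma> n \<zeta> i > 0) \<and>
     (\<forall>i\<in>{1..n}. ((\<lambda>t. J k \<sigma> n (y(i := t)) \<zeta>) has_real_derivative 0) (at (y i))) \<and>
     (\<forall>i\<in>{1..<n}. ((\<lambda>t. J k \<sigma> n y (\<zeta>(i := t))) has_real_derivative 0) (at (\<zeta> i)))"

end

theory Submission
  imports Defs
begin

text \<open>The relation for the levels holds because \<open>mmse = J - k\<^sup>2 W\<close>, where the distortion \<open>W\<close> is
  a quadratic polynomial in \<open>y i\<close>: no smoothness of \<open>mmse\<close> has to be known in advance. For the
  thresholds, \<open>mmse\<close> is a minimum over estimators \<open>f\<close> of \<open>\<Sum>j. w j * Psi f (y j)\<close>, which is linear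
  in the weights. Freezing \<open>f = m\<close> gives an explicit differentiable majorant of \<open>J\<close> that touches it
  at the stationary point, so its derivative vanishes there as well. Finally \<open>\<bar>m\<bar>\<close> is bounded by
  the largest \<open>\<bar>y i\<bar>\<close>, which makes \<open>Psi m\<close> Lipschitz with a constant depending on this bound only.\<close>

section \<open>The centred Gaussian measure\<close>

lemma prob_space_gauss: "\<sigma> > 0 \<Longrightarrow> prob_space (gauss \<sigma>)"
  unfolding gauss_def by (rule prob_space_normal_density)

lemma sets_gauss [measurable_cong, simp]: "sets (gauss \<sigma>) = sets borel"
  by (simp add: gauss_def)

lemma space_gauss [simp]: "space (gauss \<sigma>) = UNIV"
  by (simp add: gauss_def)

lemma AE_gauss_iff: "\<sigma> > 0 \<Longrightarrow> (AE x in gauss \<sigma>. P x) \<longleftrightarrow> (AE x in lborel. P x)"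
  unfolding gauss_def by (subst AE_density) (auto simp: normal_density_pos)

lemma integral_gauss:
  fixes f :: "real \<Rightarrow> real"
  assumes [measurable]: "f \<in> borel_measurable borel"
  shows "(\<integral>x. f x \<partial>gauss \<sigma>) = (\<integral>x. normal_density 0 \<sigma> x * f x \<partial>lborel)"
  unfolding gauss_def by (subst integral_density) auto

section \<open>The Gaussian channel with a bounded input; optimality of the conditional mean\<close>

text \<open>The bound \<open>R\<close> makes every squared error integrable and passes from the
  input to its conditional mean. A finitely supported input satisfies it with any \<open>R\<close>
  dominating all \<bar>\<open>y i\<close>\<bar>.\<close>

locale bounded_prior = prob_space Q for Q :: "real measure" +
  fixes R :: real
  assumes sets_Q [measurable_cong, simp]: "sets Q = sets borel"
    and bounded_Q: "AE x in Q. \<bar>x\<bar> \<le> R"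
begin

lemma space_Q [simp]: "space Q = UNIV"
  using sets_eq_imp_space_eq[OF sets_Q] by simp

sublocale noise: prob_space "gauss 1"
  by (rule prob_space_gauss) simp

sublocale channel: pair_prob_space Q "gauss 1" ..

lemma sets_chan [measurable_cong, simp]: "sets (chan Q) = sets borel"
  unfolding chan_def borel_prod[symmetric] by (intro sets_pair_measure_cong) auto

lemma space_chan [simp]: "space (chan Q) = UNIV"
  using sets_eq_imp_space_eq[OF sets_chan] by simp

lemma prob_space_chan: "prob_space (chan Q)"
  unfolding chan_def by (rule channel.prob_space_axioms)

lemma obs_measurable [measurable]: "(\<lambda>\<omega>. fst \<omega> + snd \<omega>) \<in> borel_measurable (chan_obs Q)"
  unfolding chan_obs_def by (rule measurable_vimage_algebra1) auto

lemma subalgebra_chan_obs: "subalgebra (chan Q) (chan_obs Q)"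
proof -
  have "(\<lambda>\<omega>. fst \<omega> + snd \<omega>) \<in> borel_measurable (chan Q)"
    unfolding measurable_cong_sets[OF sets_chan refl] borel_prod[symmetric] by measurable
  then have "sets (chan_obs Q) \<subseteq> sets (chan Q)"
    unfolding chan_obs_def by (intro sets_image_in_sets) auto
  then show ?thesis
    by (simp add: subalgebra_def) (simp add: chan_obs_def)
qed

sublocale obs: finite_measure_subalgebra "chan Q" "chan_obs Q"
  using prob_space_chan subalgebra_chan_obs
  by (simp add: finite_measure_subalgebra_def finite_measure_subalgebra_axioms_def prob_space_def)

lemma bounded_fst: "AE \<omega> in chan Q. \<bar>fst \<omega>\<bar> \<le> R"
proof -
  have "distr (chan Q) Q fst = Q"
    unfolding chan_def by (rule noise.distr_pair_fst)
  then have "AE x in distr (chan Q) Q fst. \<bar>x\<bar> \<le> R"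
    by (rule ssubst) (rule bounded_Q)
  then show ?thesis
    by (rule AE_distrD[rotated]) (simp add: chan_def)
qed

lemma integrable_bounded:
  fixes f :: "real \<times> real \<Rightarrow> real"
  assumes "f \<in> borel_measurable (chan Q)" "AE \<omega> in chan Q. \<bar>f \<omega>\<bar> \<le> B"
  shows "integrable (chan Q) f"
  using obs.integrable_const_bound[of f B] assms by simp


lemma cond_mean_measurable [measurable]: "cond_mean Q \<in> borel_measurable (chan_obs Q)"
  unfolding cond_mean_def by simp

lemma chan_obs_measurable_chan:
  "f \<in> borel_measurable (chan_obs Q) \<Longrightarrow> f \<in> borel_measurable (chan Q)"
  by (rule measurable_from_subalg[OF subalgebra_chan_obs])

lemma fst_measurable [measurable]: "fst \<in> borel_measurable (chan Q)"
  by (simp add: measurable_cong_sets[OF sets_chan refl] borel_prod[symmetric])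

lemma integrable_fst: "integrable (chan Q) fst"
  by (rule integrable_bounded[OF fst_measurable bounded_fst])

lemma bounded_cond_mean: "AE \<omega> in chan Q. \<bar>cond_mean Q \<omega>\<bar> \<le> R"
proof -
  have "AE \<omega> in chan Q. cond_mean Q \<omega> \<le> R"
    unfolding cond_mean_def using bounded_fst
    by (intro obs.real_cond_exp_le_c integrable_fst) auto
  moreover have "AE \<omega> in chan Q. - R \<le> cond_mean Q \<omega>"
    unfolding cond_mean_def using bounded_fst
    by (intro obs.real_cond_exp_ge_c integrable_fst) auto
  ultimately show ?thesis
    by eventually_elim simp
qed

lemma integrable_square_error:
  assumes "g \<in> borel_measurable (chan Q)" "AE \<omega> in chan Q. \<bar>g \<omega>\<bar> \<le> B"
  shows "integrable (chan Q) (\<lambda>\<omega>. (fst \<omega> - g \<omega>)\<^sup>2)"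
proof (rule integrable_bounded)
  show "(\<lambda>\<omega>. (fst \<omega> - g \<omega>)\<^sup>2) \<in> borel_measurable (chan Q)"
    using assms(1) by measurable
  show "AE \<omega> in chan Q. \<bar>(fst \<omega> - g \<omega>)\<^sup>2\<bar> \<le> (R + B)\<^sup>2"
    using bounded_fst assms(2)
  proof eventually_elim
    case (elim \<omega>)
    then have "\<bar>fst \<omega> - g \<omega>\<bar> \<le> \<bar>R + B\<bar>" by linarith
    then show ?case by (simp add: abs_le_square_iff)
  qed
qed

text \<open>Integrating a conditional expectation over the whole space undoes the conditioning, so
  the mean conditional variance is the mean squared error of \<open>cond_mean\<close>.\<close>

lemma mmse_eq: "mmse Q = (\<integral>\<omega>. (fst \<omega> - cond_mean Q \<omega>)\<^sup>2 \<partial>chan Q)"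
  unfolding mmse_def cond_var_def
  by (intro obs.real_cond_exp_int(2) integrable_square_error[OF _ bounded_cond_mean]
      chan_obs_measurable_chan cond_mean_measurable)

text \<open>Pythagoras in L2: the error of the conditional mean is orthogonal to every bounded
  function of the observation, so the error of \<open>g\<close> exceeds the minimum by the mean of
  \<open>(M - g)^2\<close>.\<close>

lemma mmse_le:
  assumes g: "g \<in> borel_measurable (chan_obs Q)" "AE \<omega> in chan Q. \<bar>g \<omega>\<bar> \<le> B"
  shows "mmse Q \<le> (\<integral>\<omega>. (fst \<omega> - g \<omega>)\<^sup>2 \<partial>chan Q)"
proof -
  define M where "M = cond_mean Q"
  have M: "M \<in> borel_measurable (chan_obs Q)" "AE \<omega> in chan Q. \<bar>M \<omega>\<bar> \<le> R"
    unfolding M_def by (auto intro: bounded_cond_mean)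
  note [measurable] = chan_obs_measurable_chan[OF M(1)] chan_obs_measurable_chan[OF g(1)]
  have D: "AE \<omega> in chan Q. \<bar>M \<omega> - g \<omega>\<bar> \<le> \<bar>R\<bar> + \<bar>B\<bar>"
    using M(2) g(2) by eventually_elim linarith
  have DY: "integrable (chan Q) (\<lambda>\<omega>. (M \<omega> - g \<omega>) * fst \<omega>)"
  proof (rule integrable_bounded)
    show "AE \<omega> in chan Q. \<bar>(M \<omega> - g \<omega>) * fst \<omega>\<bar> \<le> (\<bar>R\<bar> + \<bar>B\<bar>) * \<bar>R\<bar>"
      using D bounded_fst unfolding abs_mult
      by eventually_elim (intro mult_mono, auto)
  qed measurable
  \<comment> \<open>\<open>M - g\<close> depends on the observation alone, so conditioning lets
    \<open>M\<close> stand in for \<open>fst\<close> under the integral. This is the orthogonality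
    relation.\<close>
  have DM: "integrable (chan Q) (\<lambda>\<omega>. (M \<omega> - g \<omega>) * M \<omega>)"
    "(\<integral>\<omega>. (M \<omega> - g \<omega>) * M \<omega> \<partial>chan Q) = (\<integral>\<omega>. (M \<omega> - g \<omega>) * fst \<omega> \<partial>chan Q)"
    unfolding M_def cond_mean_def
    using M g DY by (auto intro!: obs.real_cond_exp_intg simp: M_def cond_mean_def)
  \<comment> \<open>The added term integrates to zero by \<open>DM\<close>; with it the integrand is
    \<open>(fst - g)^2 - (M - g)^2\<close>, which is pointwise at most
    \<open>(fst - g)^2\<close>.\<close>
  have "mmse Q = (\<integral>\<omega>. (fst \<omega> - M \<omega>)\<^sup>2 + 2 * ((M \<omega> - g \<omega>) * fst \<omega> - (M \<omega> - g \<omega>) * M \<omega>) \<partial>chan Q)"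
    unfolding mmse_eq M_def[symmetric]
    using DY DM integrable_square_error[OF _ M(2)] by simp
  also have "\<dots> \<le> (\<integral>\<omega>. (fst \<omega> - g \<omega>)\<^sup>2 \<partial>chan Q)"
  proof (rule integral_mono)
    fix \<omega>
    have "(fst \<omega> - g \<omega>)\<^sup>2 - ((fst \<omega> - M \<omega>)\<^sup>2 + 2 * ((M \<omega> - g \<omega>) * fst \<omega> - (M \<omega> - g \<omega>) * M \<omega>)) = (M \<omega> - g \<omega>)\<^sup>2"
      by (simp add: algebra_simps power2_eq_square)
    then show "(fst \<omega> - M \<omega>)\<^sup>2 + 2 * ((M \<omega> - g \<omega>) * fst \<omega> - (M \<omega> - g \<omega>) * M \<omega>) \<le> (fst \<omega> - g \<omega>)\<^sup>2"
      by (smt (verit) zero_le_power2)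
  next
    show "integrable (chan Q) (\<lambda>\<omega>. (fst \<omega> - M \<omega>)\<^sup>2 + 2 * ((M \<omega> - g \<omega>) * fst \<omega> - (M \<omega> - g \<omega>) * M \<omega>))"
      using DY DM integrable_square_error[OF _ M(2)] by simp
    show "integrable (chan Q) (\<lambda>\<omega>. (fst \<omega> - g \<omega>)\<^sup>2)"
      by (rule integrable_square_error[OF _ g(2)]) measurable
  qed
  finally show ?thesis .
qed

text \<open>The law of the observation dominates Lebesgue measure because the noise density is positive.\<close>

lemma AE_chan_sum_imp_AE_lborel:
  assumes "AE \<omega> in chan Q. P (fst \<omega> + snd \<omega>)" and [measurable]: "Measurable.pred borel P"
  shows "AE z in lborel. P z"
proof -
  have "AE x in Q. AE s in gauss 1. P (x + s)"
    using channel.AE_pair[OF assms(1)[unfolded chan_def]] by simp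
  \<comment> \<open>One good input value \<open>x\<close> is enough: \<open>gauss 1\<close> and
    Lebesgue measure have the same null sets, and translation by \<open>x\<close> preserves
    them.\<close>
  then have "\<exists>x. AE s in gauss 1. P (x + s)"
    using eventually_happens ae_filter_bot by blast
  then obtain x where "AE s in lborel. P (x + s)"
    by (auto simp: AE_gauss_iff)
  from AE_borel_affine[OF _ _ this, of 1 "- x"] show ?thesis
    by simp
qed

lemma bounded_regression:
  assumes "is_regression Q m"
  shows "AE z in lborel. \<bar>m z\<bar> \<le> R"
proof (rule AE_chan_sum_imp_AE_lborel)
  have "AE \<omega> in chan Q. cond_mean Q \<omega> = m (fst \<omega> + snd \<omega>)"
    using assms by (simp add: is_regression_def)
  with bounded_cond_mean show "AE \<omega> in chan Q. \<bar>m (fst \<omega> + snd \<omega>)\<bar> \<le> R"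
    by eventually_elim simp
  have [measurable]: "m \<in> borel_measurable borel"
    using assms by (simp add: is_regression_def)
  show "Measurable.pred borel (\<lambda>z. \<bar>m z\<bar> \<le> R)"
    by measurable
qed

end

section \<open>Discrete inputs: mean squared error as a weighted sum of \<open>Psi\<close>\<close>

lemma prob_space_discr:
  assumes "\<And>i. i \<in> {1..n} \<Longrightarrow> 0 \<le> w i" "(\<Sum>i\<in>{1..n}. w i) = 1"
  shows "prob_space (discr n w y)"
proof
  have space: "space (discr n w y) = UNIV"
    by (simp add: discr_def)
  have "emeasure (discr n w y) (space (discr n w y)) = (\<Sum>i\<in>{1..n}. ennreal (w i))"
    unfolding space by (subst emeasure_discr) auto
  also have "\<dots> = ennreal (\<Sum>i\<in>{1..n}. w i)"
    by (rule sum_ennreal) (rule assms(1))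
  finally show "emeasure (discr n w y) (space (discr n w y)) = 1"
    by (simp only: assms(2) ennreal_1)
qed

lemma bounded_prior_discr:
  assumes "\<And>i. i \<in> {1..n} \<Longrightarrow> 0 \<le> w i" "(\<Sum>i\<in>{1..n}. w i) = 1"
    and "\<And>i. i \<in> {1..n} \<Longrightarrow> \<bar>y i\<bar> \<le> R"
  shows "bounded_prior (discr n w y) R"
proof -
  have "AE x in discr n w y. \<bar>x\<bar> \<le> R"
    unfolding discr_def using assms(3) by (subst AE_distr_iff) (auto simp: AE_point_measure)
  then show ?thesis
    using prob_space_discr[OF assms(1,2)]
    by (auto simp: bounded_prior_def bounded_prior_axioms_def) (simp_all add: discr_def)
qed

lemma integral_discr:
  fixes f :: "real \<Rightarrow> real"
  assumes "f \<in> borel_measurable borel" "\<And>i. i \<in> {1..n} \<Longrightarrow> 0 \<le> w i"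
  shows "(\<integral>x. f x \<partial>discr n w y) = (\<Sum>i\<in>{1..n}. w i * f (y i))"
proof -
  have "(\<integral>x. f x \<partial>discr n w y) = (\<integral>i. f (y i) \<partial>point_measure {1..n} (\<lambda>i. ennreal (w i)))"
    unfolding discr_def using assms(1) by (subst integral_distr) auto
  also have "\<dots> = (\<Sum>i\<in>{1..n}. w i *\<^sub>R f (y i))"
    by (rule lebesgue_integral_point_measure_finite) (use assms(2) in auto)
  finally show ?thesis by simp
qed

lemma shifted_std_normal_density: "std_normal_density (z - c) = normal_density c 1 z"
  by (simp add: normal_density_def)

lemma integrable_shifted_density:
  fixes f :: "real \<Rightarrow> real"
  assumes [measurable]: "f \<in> borel_measurable borel" and "AE z in lborel. \<bar>f z\<bar> \<le> B"
  shows "integrable lborel (\<lambda>z. f z * std_normal_density (z - c))"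
proof (rule Bochner_Integration.integrable_bound)
  show "integrable lborel (\<lambda>z. B * normal_density c 1 z)"
    by simp
  show "AE z in lborel. norm (f z * std_normal_density (z - c)) \<le> norm (B * normal_density c 1 z)"
    using assms(2) by eventually_elim (auto simp: abs_mult shifted_std_normal_density intro!: mult_right_mono)
qed measurable

lemma integral_shifted_density: "(\<integral>z. std_normal_density (z - c) \<partial>lborel) = 1"
  by (simp add: shifted_std_normal_density)

text \<open>Given the input value \<open>c\<close>, the observation is \<open>c + s\<close> with
  \<open>s\<close> standard normal, so \<open>Psi m c\<close> is the conditional mean squared error
  of the estimator \<open>m\<close>. Expanding the square and using that the density has mass 1
  gives its three terms.\<close>

lemma Psi_eq_integral:
  assumes [measurable]: "m \<in> borel_measurable borel" and bdd: "AE z in lborel. \<bar>m z\<bar> \<le> B"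
  shows "Psi m c = (\<integral>s. (c - m (c + s))\<^sup>2 \<partial>gauss 1)"
proof -
  have bdd2: "AE z in lborel. \<bar>(m z)\<^sup>2\<bar> \<le> B\<^sup>2"
    using bdd by eventually_elim (simp add: abs_le_square_iff[symmetric])
  have i: "integrable lborel (\<lambda>z. 1 * std_normal_density (z - c))"
    "integrable lborel (\<lambda>z. m z * std_normal_density (z - c))"
    "integrable lborel (\<lambda>z. (m z)\<^sup>2 * std_normal_density (z - c))"
    using integrable_shifted_density[of "\<lambda>_. 1" 1 c] integrable_shifted_density[OF _ bdd]
      integrable_shifted_density[OF _ bdd2] by auto
  have "(\<integral>s. (c - m (c + s))\<^sup>2 \<partial>gauss 1)
      = (\<integral>s. std_normal_density s * (c - m (c + s))\<^sup>2 \<partial>lborel)"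
    by (rule integral_gauss) measurable
  also have "\<dots> = (\<integral>z. std_normal_density (z - c) * (c - m z)\<^sup>2 \<partial>lborel)"
    by (subst lborel_integral_real_affine[where c = 1 and t = "- c"]) auto
  also have "\<dots> = (\<integral>z. c\<^sup>2 * (1 * std_normal_density (z - c))
      - 2 * c * (m z * std_normal_density (z - c))
      + (m z)\<^sup>2 * std_normal_density (z - c) \<partial>lborel)"
    by (intro Bochner_Integration.integral_cong) (auto simp: power2_eq_square algebra_simps)
  also have "\<dots> = Psi m c"
    using i by (simp add: Psi_def a_fun_def b_fun_def integral_shifted_density)
  finally show ?thesis by simp
qed

lemma Psi_cong_AE:
  assumes [measurable]: "f \<in> borel_measurable borel" "g \<in> borel_measurable borel"
    and "AE z in lborel. f z = g z"
  shows "Psi f c = Psi g c"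
proof -
  have "a_fun f c = a_fun g c" "b_fun f c = b_fun g c"
    unfolding a_fun_def b_fun_def using assms(3)
    by (auto intro!: integral_cong_AE)
  then show ?thesis by (simp add: Psi_def)
qed

text \<open>Fubini, integrating the noise first for each level. For a frozen estimator
  \<open>f\<close> the error is linear in the weights, since the numbers \<open>Psi f (y i)\<close>
  do not involve them.\<close>

lemma integral_square_error_discr:
  assumes w: "\<And>i. i \<in> {1..n} \<Longrightarrow> 0 \<le> w i" "(\<Sum>i\<in>{1..n}. w i) = 1"
    and [measurable]: "f \<in> borel_measurable borel" and bdd: "\<And>z. \<bar>f z\<bar> \<le> B"
  shows "(\<integral>\<omega>. (fst \<omega> - f (fst \<omega> + snd \<omega>))\<^sup>2 \<partial>chan (discr n w y)) = (\<Sum>i\<in>{1..n}. w i * Psi f (y i))"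
proof -
  interpret bounded_prior "discr n w y" "Max ((\<lambda>i. \<bar>y i\<bar>) ` {1..n})"
    by (intro bounded_prior_discr w) auto
  have "integrable (chan (discr n w y)) (\<lambda>\<omega>. (fst \<omega> - f (fst \<omega> + snd \<omega>))\<^sup>2)"
    using bdd by (intro integrable_square_error[where B = B] chan_obs_measurable_chan) auto
  from channel.integral_fst'[OF this[unfolded chan_def]]
  have "(\<integral>\<omega>. (fst \<omega> - f (fst \<omega> + snd \<omega>))\<^sup>2 \<partial>chan (discr n w y))
      = (\<integral>x. (\<integral>s. (x - f (x + s))\<^sup>2 \<partial>gauss 1) \<partial>discr n w y)"
    by (simp add: chan_def)
  also have "\<dots> = (\<Sum>i\<in>{1..n}. w i * (\<integral>s. (y i - f (y i + s))\<^sup>2 \<partial>gauss 1))"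
    using w(1) by (intro integral_discr) measurable
  also have "\<dots> = (\<Sum>i\<in>{1..n}. w i * Psi f (y i))"
    using bdd by (simp add: Psi_eq_integral[of f B])
  finally show ?thesis .
qed

text \<open>A regression obeys the bound \<open>R\<close> only up to a null set. Clipping it to
  \<open>[-R, R]\<close> gives a version bounded everywhere, which can serve as an estimator under
  other weights, and \<open>Psi\<close> does not notice the change.\<close>

lemma regression_bounded_version:
  assumes w: "\<And>i. i \<in> {1..n} \<Longrightarrow> 0 \<le> w i" "(\<Sum>i\<in>{1..n}. w i) = 1"
    and R: "\<And>i. i \<in> {1..n} \<Longrightarrow> \<bar>y i\<bar> \<le> R"
    and m: "is_regression (discr n w y) m"
  obtains f where "is_regression (discr n w y) f" "f \<in> borel_measurable borel"
    "\<And>z. \<bar>f z\<bar> \<le> R" "\<And>c. Psi m c = Psi f c"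
proof
  interpret bounded_prior "discr n w y" R
    by (intro bounded_prior_discr w R)
  define f where "f z = max (- R) (min R (m z))" for z
  have [measurable]: "m \<in> borel_measurable borel" using m by (simp add: is_regression_def)
  show [measurable]: "f \<in> borel_measurable borel" unfolding f_def by measurable
  \<comment> \<open>Weights with sum 1 force at least one level to exist, whence \<open>R\<close> is
    nonnegative and the clipping interval is nonempty.\<close>
  have "1 \<in> {1..n}" using w(2) by (cases n) auto
  then have "0 \<le> R" using R[of 1] by simp
  then show "\<bar>f z\<bar> \<le> R" for z by (auto simp: f_def)
  have "AE z in lborel. m z = f z"
    using bounded_regression[OF m] by eventually_elim (auto simp: f_def)
  then show "Psi m c = Psi f c" for c
    by (intro Psi_cong_AE) auto
  have "AE \<omega> in chan (discr n w y). cond_mean (discr n w y) \<omega> = m (fst \<omega> + snd \<omega>)"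
    using m by (simp add: is_regression_def)
  with bounded_cond_mean
  have "AE \<omega> in chan (discr n w y). cond_mean (discr n w y) \<omega> = f (fst \<omega> + snd \<omega>)"
    by eventually_elim (auto simp: f_def)
  then show "is_regression (discr n w y) f"
    by (simp add: is_regression_def)
qed

text \<open>The regression evaluated at the observation is the conditional mean almost surely, so
  its error is the minimal one.\<close>

lemma mmse_discr_eq_sum_Psi:
  assumes w: "\<And>i. i \<in> {1..n} \<Longrightarrow> 0 \<le> w i" "(\<Sum>i\<in>{1..n}. w i) = 1"
    and m: "is_regression (discr n w y) m"
  shows "mmse (discr n w y) = (\<Sum>i\<in>{1..n}. w i * Psi m (y i))"
proof -
  define R where "R = Max ((\<lambda>i. \<bar>y i\<bar>) ` {1..n})"
  have R: "\<bar>y i\<bar> \<le> R" if "i \<in> {1..n}" for i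
    using that by (auto simp: R_def)
  obtain f where f: "is_regression (discr n w y) f" "f \<in> borel_measurable borel"
    "\<And>z. \<bar>f z\<bar> \<le> R" "\<And>c. Psi m c = Psi f c"
    using regression_bounded_version[OF w R m] by metis
  interpret bounded_prior "discr n w y" R
    by (intro bounded_prior_discr w R)
  have [measurable]: "f \<in> borel_measurable borel" by (rule f)
  have "AE \<omega> in chan (discr n w y). (fst \<omega> - cond_mean (discr n w y) \<omega>)\<^sup>2 = (fst \<omega> - f (fst \<omega> + snd \<omega>))\<^sup>2"
    using f(1) unfolding is_regression_def by auto
  moreover have "(\<lambda>\<omega>. f (fst \<omega> + snd \<omega>)) \<in> borel_measurable (chan (discr n w y))"
    by (rule chan_obs_measurable_chan) measurable
  ultimately have "mmse (discr n w y) = (\<integral>\<omega>. (fst \<omega> - f (fst \<omega> + snd \<omega>))\<^sup>2 \<partial>chan (discr n w y))"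
    unfolding mmse_eq using chan_obs_measurable_chan[OF cond_mean_measurable]
    by (intro integral_cong_AE) auto
  also have "\<dots> = (\<Sum>i\<in>{1..n}. w i * Psi m (y i))"
    unfolding f(4) by (rule integral_square_error_discr[OF w f(2,3)])
  finally show ?thesis .
qed

text \<open>Here \<open>m\<close> is the regression for the weights \<open>w\<close> but estimates
  an input with weights \<open>v\<close> on the same levels. It is merely a competitor there, hence
  the inequality.\<close>

lemma mmse_discr_le_sum_Psi:
  assumes w: "\<And>i. i \<in> {1..n} \<Longrightarrow> 0 \<le> w i" "(\<Sum>i\<in>{1..n}. w i) = 1"
    and v: "\<And>i. i \<in> {1..n} \<Longrightarrow> 0 \<le> v i" "(\<Sum>i\<in>{1..n}. v i) = 1"
    and m: "is_regression (discr n w y) m"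
  shows "mmse (discr n v y) \<le> (\<Sum>i\<in>{1..n}. v i * Psi m (y i))"
proof -
  define R where "R = Max ((\<lambda>i. \<bar>y i\<bar>) ` {1..n})"
  have R: "\<bar>y i\<bar> \<le> R" if "i \<in> {1..n}" for i
    using that by (auto simp: R_def)
  obtain f where f: "f \<in> borel_measurable borel" "\<And>z. \<bar>f z\<bar> \<le> R" "\<And>c. Psi m c = Psi f c"
    using regression_bounded_version[OF w R m] by metis
  interpret bounded_prior "discr n v y" R
    by (intro bounded_prior_discr v R)
  have [measurable]: "f \<in> borel_measurable borel" by (rule f)
  have "mmse (discr n v y) \<le> (\<integral>\<omega>. (fst \<omega> - f (fst \<omega> + snd \<omega>))\<^sup>2 \<partial>chan (discr n v y))"
    using f(2) by (intro mmse_le[where B = R]) auto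
  also have "\<dots> = (\<Sum>i\<in>{1..n}. v i * Psi m (y i))"
    unfolding f(3) by (rule integral_square_error_discr[OF v f(1,2)])
  finally show ?thesis .
qed

section \<open>Lipschitz continuity of \<open>Psi\<close>, uniform over bounded estimators\<close>

text \<open>Since \<open>\<bar>u\<bar> \<le> 1 + u\<^sup>2/4 \<le> exp (u\<^sup>2/4)\<close>, the derivative of the density at \<open>u = z - c\<close> is
  dominated by a Gaussian of variance 4 in \<open>z\<close>, uniformly in \<open>\<bar>c\<bar> \<le> R\<close>.\<close>

lemma shifted_density_Lipschitz:
  fixes R :: real
  obtains C where "0 \<le> C"
    "\<And>z x y. \<bar>x\<bar> \<le> R \<Longrightarrow> \<bar>y\<bar> \<le> R \<Longrightarrow>
      \<bar>std_normal_density (z - x) - std_normal_density (z - y)\<bar> \<le> C * normal_density 0 2 z * \<bar>x - y\<bar>"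
proof
  \<comment> \<open>The factor 2 is the ratio of the normalizing constants for standard deviations 2
    and 1; the exponential pays for recentring the Gaussian from \<open>c\<close> to 0.\<close>
  define C where "C = 2 * exp (R\<^sup>2 / 4)"
  show "0 \<le> C" by (simp add: C_def)
  have deriv_bound: "\<bar>(z - c) * std_normal_density (z - c)\<bar> \<le> C * normal_density 0 2 z"
    if "\<bar>c\<bar> \<le> R" for z c
  proof -
    define u where "u = z - c"
    have "c\<^sup>2 \<le> R\<^sup>2" using that by (simp add: abs_le_square_iff[symmetric])
    \<comment> \<open>Half of this square is \<open>u^2 - (z^2 / 2 - c^2)\<close>.\<close>
    have "0 \<le> (z - 2 * c)\<^sup>2" by simp
    then have "z\<^sup>2 / 2 - c\<^sup>2 \<le> u\<^sup>2"
      by (simp add: u_def power2_eq_square algebra_simps)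
    with \<open>c\<^sup>2 \<le> R\<^sup>2\<close> have q: "- u\<^sup>2 / 4 \<le> R\<^sup>2 / 4 + - z\<^sup>2 / 8" by linarith
    have "0 \<le> (\<bar>u\<bar> / 2 - 1)\<^sup>2" by simp
    then have "\<bar>u\<bar> \<le> 1 + u\<^sup>2 / 4" by (simp add: power2_eq_square algebra_simps)
    also have "\<dots> \<le> exp (u\<^sup>2 / 4)" by (rule exp_ge_add_one_self)
    finally have "\<bar>u\<bar> * exp (- u\<^sup>2 / 2) \<le> exp (u\<^sup>2 / 4) * exp (- u\<^sup>2 / 2)"
      by (rule mult_right_mono) simp
    also have "\<dots> = exp (- u\<^sup>2 / 4)" by (simp flip: exp_add)
    also have "\<dots> \<le> exp (R\<^sup>2 / 4) * exp (- z\<^sup>2 / 8)" using q by (simp flip: exp_add)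
    finally have "\<bar>u\<bar> * exp (- u\<^sup>2 / 2) / sqrt (2 * pi) \<le> exp (R\<^sup>2 / 4) * exp (- z\<^sup>2 / 8) / sqrt (2 * pi)"
      by (rule divide_right_mono) simp
    moreover have "sqrt (2 * pi * 2\<^sup>2) = 2 * sqrt (2 * pi)"
      by (simp only: real_sqrt_mult real_sqrt_abs)
    ultimately show ?thesis
      by (simp add: C_def normal_density_def abs_mult u_def)
  qed
  fix z x y :: real
  assume "\<bar>x\<bar> \<le> R" "\<bar>y\<bar> \<le> R"
  have deriv: "((\<lambda>c. K * exp (- (z - c)\<^sup>2 / 2)) has_field_derivative (z - c) * (K * exp (- (z - c)\<^sup>2 / 2)))
      (at c within S)" for K c S
    by (auto intro!: derivative_eq_intros simp: field_simps)
  \<comment> \<open>Mean value inequality in the shift on the convex set \<open>{-R..R}\<close>;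
    differentiating in \<open>c\<close> rather than in \<open>z\<close> gives the factor
    \<open>z - c\<close> with a positive sign.\<close>
  have "norm (std_normal_density (z - x) - std_normal_density (z - y)) \<le> C * normal_density 0 2 z * norm (x - y)"
  proof (rule field_differentiable_bound[where S = "{-R..R}" and f' = "\<lambda>c. (z - c) * std_normal_density (z - c)"])
    fix c assume "c \<in> {-R..R}"
    then show "norm ((z - c) * std_normal_density (z - c)) \<le> C * normal_density 0 2 z"
      unfolding real_norm_def by (intro deriv_bound) auto
    show "((\<lambda>c. std_normal_density (z - c)) has_field_derivative (z - c) * std_normal_density (z - c)) (at c within {-R..R})"
      unfolding std_normal_density_def by (rule deriv)
  qed (use \<open>\<bar>x\<bar> \<le> R\<close> \<open>\<bar>y\<bar> \<le> R\<close> in auto)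
  then show "\<bar>std_normal_density (z - x) - std_normal_density (z - y)\<bar> \<le> C * normal_density 0 2 z * \<bar>x - y\<bar>"
    by simp
qed

text \<open>The kernel bound is integrated against \<open>f\<close>; the dominating Gaussian has
  mass 1, so only constants remain. \<open>C\<close> is fixed before \<open>f\<close> and
  \<open>B\<close>, which keeps it uniform over estimators.\<close>

lemma smoothing_Lipschitz:
  obtains C where "0 \<le> C"
    "\<And>f B x y. f \<in> borel_measurable borel \<Longrightarrow> (\<And>z. \<bar>f z\<bar> \<le> B) \<Longrightarrow> \<bar>x\<bar> \<le> R \<Longrightarrow> \<bar>y\<bar> \<le> R \<Longrightarrow>
      \<bar>(\<integral>z. f z * std_normal_density (z - x) \<partial>lborel) - (\<integral>z. f z * std_normal_density (z - y) \<partial>lborel)\<bar>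
        \<le> B * C * \<bar>x - y\<bar>"
proof -
  obtain C where C: "0 \<le> C" "\<And>z x y. \<bar>x\<bar> \<le> R \<Longrightarrow> \<bar>y\<bar> \<le> R \<Longrightarrow>
      \<bar>std_normal_density (z - x) - std_normal_density (z - y)\<bar> \<le> C * normal_density 0 2 z * \<bar>x - y\<bar>"
    using shifted_density_Lipschitz by blast
  show thesis
  proof (rule that[OF C(1)])
    fix f :: "real \<Rightarrow> real" and B x y
    assume f: "f \<in> borel_measurable borel" and B: "\<And>z. \<bar>f z\<bar> \<le> B" and xy: "\<bar>x\<bar> \<le> R" "\<bar>y\<bar> \<le> R"
    have i: "integrable lborel (\<lambda>z. f z * std_normal_density (z - c))" for c
      by (rule integrable_shifted_density[OF f]) (use B in auto)
    have "0 \<le> B" using B[of 0] by linarith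
    have "\<bar>(\<integral>z. f z * std_normal_density (z - x) \<partial>lborel) - (\<integral>z. f z * std_normal_density (z - y) \<partial>lborel)\<bar>
        = norm (\<integral>z. f z * std_normal_density (z - x) - f z * std_normal_density (z - y) \<partial>lborel)"
      using i by simp
    also have "\<dots> \<le> (\<integral>z. B * (C * normal_density 0 2 z * \<bar>x - y\<bar>) \<partial>lborel)"
    proof (rule Bochner_Integration.integral_norm_bound_integral)
      fix z
      have "\<bar>f z\<bar> * \<bar>std_normal_density (z - x) - std_normal_density (z - y)\<bar>
          \<le> B * (C * normal_density 0 2 z * \<bar>x - y\<bar>)"
        using B C(2)[OF xy] \<open>0 \<le> B\<close> by (intro mult_mono) auto
      then show "norm (f z * std_normal_density (z - x) - f z * std_normal_density (z - y))
          \<le> B * (C * normal_density 0 2 z * \<bar>x - y\<bar>)"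
        by (simp add: abs_mult flip: right_diff_distrib)
    qed (use i in auto)
    also have "\<dots> = B * C * \<bar>x - y\<bar>" by simp
    finally show "\<bar>(\<integral>z. f z * std_normal_density (z - x) \<partial>lborel) - (\<integral>z. f z * std_normal_density (z - y) \<partial>lborel)\<bar>
        \<le> B * C * \<bar>x - y\<bar>" .
  qed
qed

text \<open>\<open>L\<close> must depend on \<open>R\<close> alone, because the regression changes
  with the configuration when the limit in \<open>k\<close> is taken.\<close>

lemma Psi_Lipschitz:
  fixes R :: real
  obtains L where "0 \<le> L"
    "\<And>f x y. f \<in> borel_measurable borel \<Longrightarrow> (\<And>z. \<bar>f z\<bar> \<le> R) \<Longrightarrow> \<bar>x\<bar> \<le> R \<Longrightarrow> \<bar>y\<bar> \<le> R \<Longrightarrow>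
      \<bar>Psi f x - Psi f y\<bar> \<le> L * \<bar>x - y\<bar>"
proof -
  obtain C where C: "0 \<le> C"
    "\<And>f B x y. f \<in> borel_measurable borel \<Longrightarrow> (\<And>z. \<bar>f z\<bar> \<le> B) \<Longrightarrow> \<bar>x\<bar> \<le> R \<Longrightarrow> \<bar>y\<bar> \<le> R \<Longrightarrow>
      \<bar>(\<integral>z. f z * std_normal_density (z - x) \<partial>lborel) - (\<integral>z. f z * std_normal_density (z - y) \<partial>lborel)\<bar>
        \<le> B * C * \<bar>x - y\<bar>"
    using smoothing_Lipschitz[of R] by blast
  \<comment> \<open>In the splitting of \<open>Psi f x - Psi f y\<close> below,
    \<open>(x - y) * (x + y)\<close> and the \<open>(x - y) * a_fun f x\<close> term cost
    \<open>2 * R\<close> each, the increment of \<open>a_fun\<close> costs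
    \<open>2 * R^2 * C\<close> and that of \<open>b_fun\<close> costs \<open>R^2 * C\<close>. The
    absolute value keeps \<open>L\<close> nonnegative for negative \<open>R\<close>, where the bound
    is vacuous.\<close>
  define L where "L = 4 * \<bar>R\<bar> + 3 * R\<^sup>2 * C"
  show thesis
  proof (rule that[of L])
    show "0 \<le> L" using C(1) by (simp add: L_def)
    fix f :: "real \<Rightarrow> real" and x y
    assume f [measurable]: "f \<in> borel_measurable borel" and fR: "\<And>z. \<bar>f z\<bar> \<le> R"
      and xy: "\<bar>x\<bar> \<le> R" "\<bar>y\<bar> \<le> R"
    have R: "0 \<le> R" using xy by linarith
    have a: "\<bar>a_fun f x - a_fun f y\<bar> \<le> R * C * \<bar>x - y\<bar>"
      unfolding a_fun_def by (rule C(2)[OF f fR xy])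
    have "\<bar>(f z)\<^sup>2\<bar> \<le> R\<^sup>2" for z
      using fR[of z] by (simp add: abs_le_square_iff[symmetric])
    then have b: "\<bar>b_fun f x - b_fun f y\<bar> \<le> R\<^sup>2 * C * \<bar>x - y\<bar>"
      unfolding b_fun_def using xy by (intro C(2)) auto
    have "norm (a_fun f x) \<le> (\<integral>z. R * std_normal_density (z - x) \<partial>lborel)"
      unfolding a_fun_def
    proof (rule Bochner_Integration.integral_norm_bound_integral)
      show "integrable lborel (\<lambda>z. f z * std_normal_density (z - x))"
        by (rule integrable_shifted_density[of _ R]) (use fR in auto)
      show "integrable lborel (\<lambda>z. R * std_normal_density (z - x))"
        by (rule integrable_shifted_density[of _ R]) (use R in auto)
      show "norm (f z * std_normal_density (z - x)) \<le> R * std_normal_density (z - x)" for z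
        using fR[of z] by (auto simp: abs_mult intro!: mult_right_mono)
    qed
    then have a': "\<bar>a_fun f x\<bar> \<le> R" by (simp add: integral_shifted_density)
    have "Psi f x - Psi f y = (x - y) * (x + y) - 2 * ((x - y) * a_fun f x)
        - 2 * (y * (a_fun f x - a_fun f y)) + (b_fun f x - b_fun f y)"
      by (simp add: Psi_def power2_eq_square algebra_simps)
    moreover have "\<bar>(x - y) * (x + y)\<bar> \<le> \<bar>x - y\<bar> * (2 * R)"
      unfolding abs_mult using xy by (intro mult_left_mono) auto
    moreover have "\<bar>(x - y) * a_fun f x\<bar> \<le> \<bar>x - y\<bar> * R"
      unfolding abs_mult using a' by (intro mult_left_mono) auto
    moreover have "\<bar>y * (a_fun f x - a_fun f y)\<bar> \<le> R * (R * C * \<bar>x - y\<bar>)"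
      unfolding abs_mult using a xy R by (intro mult_mono) auto
    ultimately have "\<bar>Psi f x - Psi f y\<bar> \<le> \<bar>x - y\<bar> * (2 * R) + 2 * (\<bar>x - y\<bar> * R)
        + 2 * (R * (R * C * \<bar>x - y\<bar>)) + R\<^sup>2 * C * \<bar>x - y\<bar>"
      using b by linarith
    also have "\<dots> = L * \<bar>x - y\<bar>"
      using R by (simp add: L_def power2_eq_square algebra_simps)
    finally show "\<bar>Psi f x - Psi f y\<bar> \<le> L * \<bar>x - y\<bar>" .
  qed
qed

section \<open>The cells partition the line, so the weights sum to 1\<close>

lemma ext_threshold_mono:
  assumes "strict_mono_on {1..<n} \<zeta>" "i \<le> j"
  shows "ext_threshold n \<zeta> i \<le> ext_threshold n \<zeta> j"
  using assms strict_mono_onD[OF assms(1), of i j]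
  by (cases "i = j") (auto simp: ext_threshold_def)

lemma cell_measurable [measurable, simp]: "cell n \<zeta> i \<in> sets borel"
  unfolding cell_def by measurable

lemma disjoint_cells:
  assumes "strict_mono_on {1..<n} \<zeta>"
  shows "disjoint_family_on (cell n \<zeta>) {1..n}"
proof -
  have "cell n \<zeta> i \<inter> cell n \<zeta> j = {}" if "i < j" for i j
  proof (rule ccontr)
    assume "\<not> ?thesis"
    then obtain x where "ereal x \<le> ext_threshold n \<zeta> i" "ext_threshold n \<zeta> (j - 1) < ereal x"
      by (auto simp: cell_def)
    moreover have "ext_threshold n \<zeta> i \<le> ext_threshold n \<zeta> (j - 1)"
      using ext_threshold_mono[OF assms] that by simp
    ultimately show False
      by (meson leD order_trans)
  qed
  then show ?thesis
    unfolding disjoint_family_on_def by (metis Int_commute linorder_neqE_nat)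
qed

lemma Union_cells:
  assumes "n \<ge> 1"
  shows "(\<Union>i\<in>{1..n}. cell n \<zeta> i) = UNIV"
proof -
  have "x \<in> (\<Union>i\<in>{1..n}. cell n \<zeta> i)" for x
  proof -
    \<comment> \<open>The cell containing \<open>x\<close> is indexed by the first extended
      threshold that is at least \<open>x\<close>. One exists as the \<open>n\<close>-th is
      infinite, and it is not the 0-th, which is minus infinity.\<close>
    define i where "i = (LEAST i. ereal x \<le> ext_threshold n \<zeta> i)"
    have top: "ereal x \<le> ext_threshold n \<zeta> n"
      using assms by (simp add: ext_threshold_def)
    have x: "ereal x \<le> ext_threshold n \<zeta> i"
      unfolding i_def using top by (rule LeastI)
    then have "i \<noteq> 0"
      by (cases "i = 0") (auto simp: ext_threshold_def)
    moreover from this have "ext_threshold n \<zeta> (i - 1) < ereal x"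
      using not_less_Least[of "i - 1" "\<lambda>i. ereal x \<le> ext_threshold n \<zeta> i"] by (simp add: i_def)
    moreover have "i \<le> n"
      unfolding i_def using top by (rule Least_le)
    ultimately show ?thesis
      using x by (auto simp: cell_def intro!: bexI[of _ i])
  qed
  then show ?thesis by auto
qed

lemma weight_nonneg: "0 \<le> weight \<sigma> n \<zeta> i"
  by (simp add: weight_def)

lemma sum_weight:
  assumes "\<sigma> > 0" "n \<ge> 1" "strict_mono_on {1..<n} \<zeta>"
  shows "(\<Sum>i\<in>{1..n}. weight \<sigma> n \<zeta> i) = 1"
proof -
  interpret prob_space "gauss \<sigma>" by (rule prob_space_gauss) fact
  have "(\<Sum>i\<in>{1..n}. weight \<sigma> n \<zeta> i) = prob (\<Union>i\<in>{1..n}. cell n \<zeta> i)"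
    unfolding weight_def
    by (intro finite_measure_finite_Union[symmetric] disjoint_cells assms) auto
  also have "\<dots> = 1"
    unfolding Union_cells[OF assms(2)] using prob_space by simp
  finally show ?thesis .
qed

section \<open>Gaussian moments over cells\<close>

lemma integrable_gauss_iff:
  fixes f :: "real \<Rightarrow> real"
  assumes "f \<in> borel_measurable borel"
  shows "integrable (gauss \<sigma>) f \<longleftrightarrow> integrable lborel (\<lambda>x. normal_density 0 \<sigma> x * f x)"
  unfolding gauss_def using assms by (subst integrable_density) auto

lemma integrable_gauss_power:
  assumes "\<sigma> > 0"
  shows "integrable (gauss \<sigma>) (\<lambda>x. x ^ p)"
  using integrable_normal_moment[OF assms, of 0 p] by (subst integrable_gauss_iff) auto

lemma set_integrable_gauss:
  fixes f :: "real \<Rightarrow> real"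
  assumes "integrable (gauss \<sigma>) f" "A \<in> sets borel"
  shows "set_integrable (gauss \<sigma>) A f"
  using assms unfolding set_integrable_def by (intro integrable_mult_indicator) auto

lemma set_integral_gauss_square:
  assumes "\<sigma> > 0" "A \<in> sets borel"
  shows "(\<integral>x\<in>A. (x - c)\<^sup>2 \<partial>gauss \<sigma>)
    = (\<integral>x\<in>A. x\<^sup>2 \<partial>gauss \<sigma>) - 2 * c * (\<integral>x\<in>A. x \<partial>gauss \<sigma>) + c\<^sup>2 * measure (gauss \<sigma>) A"
proof -
  interpret prob_space "gauss \<sigma>" by (rule prob_space_gauss) fact
  have i: "integrable (gauss \<sigma>) (\<lambda>x. indicator A x * x)"
    "integrable (gauss \<sigma>) (\<lambda>x. indicator A x * x\<^sup>2)"
    "integrable (gauss \<sigma>) (indicator A :: real \<Rightarrow> real)"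
    using set_integrable_gauss[OF integrable_gauss_power[OF assms(1), of 1] assms(2)]
      set_integrable_gauss[OF integrable_gauss_power[OF assms(1), of 2] assms(2)]
      set_integrable_gauss[OF integrable_gauss_power[OF assms(1), of 0] assms(2)]
    by (simp_all add: set_integrable_def)
  have "(\<integral>x\<in>A. (x - c)\<^sup>2 \<partial>gauss \<sigma>)
      = (\<integral>x. indicator A x * x\<^sup>2 - 2 * c * (indicator A x * x) + c\<^sup>2 * indicator A x \<partial>gauss \<sigma>)"
    unfolding set_lebesgue_integral_def
    by (intro Bochner_Integration.integral_cong) (auto simp: power2_eq_square algebra_simps)
  also have "\<dots> = (\<integral>x\<in>A. x\<^sup>2 \<partial>gauss \<sigma>) - 2 * c * (\<integral>x\<in>A. x \<partial>gauss \<sigma>) + c\<^sup>2 * measure (gauss \<sigma>) A"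
    using i assms(2) by (simp add: set_lebesgue_integral_def)
  finally show ?thesis .
qed

section \<open>Moving a single threshold\<close>

lemma threshold_neighbourhood:
  assumes "strict_mono_on {1..<n} \<zeta>" "i \<in> {1..<n}"
  obtains a b where "a < \<zeta> i" "\<zeta> i < b"
    "ext_threshold n \<zeta> (i - 1) \<le> ereal a" "ereal b \<le> ext_threshold n \<zeta> (i + 1)"
    "\<And>t. a < t \<Longrightarrow> t < b \<Longrightarrow> strict_mono_on {1..<n} (\<zeta>(i := t))"
proof -
  \<comment> \<open>The range is the gap between the neighbouring thresholds. The first and the last
    threshold lack a finite neighbour on one side, where distance 1 is an arbitrary choice.\<close>
  define a where "a = (if i = 1 then \<zeta> i - 1 else \<zeta> (i - 1))"
  define b where "b = (if i + 1 = n then \<zeta> i + 1 else \<zeta> (i + 1))"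
  have mono: "\<zeta> p < \<zeta> q" if "1 \<le> p" "p < q" "q < n" for p q
    using strict_mono_onD[OF assms(1), of p q] that by simp
  have mono': "\<zeta> p \<le> \<zeta> q" if "1 \<le> p" "p \<le> q" "q < n" for p q
    using mono[of p q] that by (cases "p = q") auto
  have ab: "a < \<zeta> i" "\<zeta> i < b"
    using mono[of "i - 1" i] mono[of i "i + 1"] assms(2) by (auto simp: a_def b_def)
  have "strict_mono_on {1..<n} (\<zeta>(i := t))" if t: "a < t" "t < b" for t
  proof (rule strict_mono_onI)
    fix p q
    assume pq: "p \<in> {1..<n}" "q \<in> {1..<n}" "p < q"
    consider "p = i" | "q = i" | "p \<noteq> i" "q \<noteq> i" by blast
    then show "(\<zeta>(i := t)) p < (\<zeta>(i := t)) q"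
    proof cases
      case 1
      with pq have "b = \<zeta> (i + 1)" by (auto simp: b_def)
      with 1 pq t mono'[of "i + 1" q] show ?thesis by auto
    next
      case 2
      with pq have "a = \<zeta> (i - 1)" by (auto simp: a_def)
      moreover have "\<zeta> p \<le> \<zeta> (i - 1)"
        using 2 pq by (intro mono') auto
      ultimately show ?thesis using 2 pq t by simp
    next
      case 3
      with pq mono[of p q] show ?thesis by simp
    qed
  qed
  moreover have "ext_threshold n \<zeta> (i - 1) \<le> ereal a" "ereal b \<le> ext_threshold n \<zeta> (i + 1)"
    using assms(2) by (auto simp: ext_threshold_def a_def b_def)
  ultimately show thesis
    using that ab by blast
qed

lemma set_integral_gauss_Ioc:
  fixes f :: "real \<Rightarrow> real"
  assumes [measurable]: "f \<in> borel_measurable borel" and "a \<le> b"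
  shows "(\<integral>x\<in>{a<..b}. f x \<partial>gauss \<sigma>) = (LBINT x=a..b. normal_density 0 \<sigma> x * f x)"
proof -
  have "(\<integral>x\<in>{a<..b}. f x \<partial>gauss \<sigma>)
      = (\<integral>x. normal_density 0 \<sigma> x * (indicator {a<..b} x *\<^sub>R f x) \<partial>lborel)"
    unfolding set_lebesgue_integral_def by (rule integral_gauss) measurable
  then show ?thesis
    using assms(2) by (simp add: interval_integral_Ioc set_lebesgue_integral_def mult.left_commute)
qed

text \<open>Moving \<open>\<zeta> i\<close> upwards hands a thin strip from cell
  \<open>i + 1\<close> to cell \<open>i\<close> and leaves the other cells alone. The rate of change
  is therefore the density at the threshold times the jump between the two integrands.\<close>

lemma has_derivative_sum_cell_integrals:
  fixes g :: "nat \<Rightarrow> real \<Rightarrow> real"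
  assumes \<sigma>: "\<sigma> > 0" and mono: "strict_mono_on {1..<n} \<zeta>" and i: "i \<in> {1..<n}"
    and int: "\<And>j. integrable (gauss \<sigma>) (g j)" and cont: "\<And>j. continuous_on UNIV (g j)"
  shows "((\<lambda>t. \<Sum>j\<in>{1..n}. \<integral>x\<in>cell n (\<zeta>(i := t)) j. g j x \<partial>gauss \<sigma>) has_real_derivative
      normal_density 0 \<sigma> (\<zeta> i) * (g i (\<zeta> i) - g (i + 1) (\<zeta> i))) (at (\<zeta> i))"
proof -
  obtain a b where ab: "a < \<zeta> i" "\<zeta> i < b"
    "ext_threshold n \<zeta> (i - 1) \<le> ereal a" "ereal b \<le> ext_threshold n \<zeta> (i + 1)"
    using threshold_neighbourhood[OF mono i] by metis
  \<comment> \<open>A reference position strictly below \<open>\<zeta> i\<close>: every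
    \<open>t\<close> in \<open>{c<..<b}\<close> lies above it, so the strip \<open>{c<..t}\<close>
    covers both directions of movement around \<open>\<zeta> i\<close>.\<close>
  define c where "c = (a + \<zeta> i) / 2"
  have c: "a < c" "c < \<zeta> i" using ab by (auto simp: c_def)
  define S where "S t j = (\<integral>x\<in>cell n (\<zeta>(i := t)) j. g j x \<partial>gauss \<sigma>)" for t j
  define D where "D j t = (LBINT x=c..t. normal_density 0 \<sigma> x * g j x)" for j t
  have si: "set_integrable (gauss \<sigma>) A (g j)" if "A \<in> sets borel" for A j
    by (rule set_integrable_gauss[OF int that])
  have sum_eq: "(\<Sum>j\<in>{1..n}. S c j) + D i t - D (i + 1) t = (\<Sum>j\<in>{1..n}. S t j)"
    if t: "t \<in> {c<..<b}" for t
  proof -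
    have D: "(\<integral>x\<in>{c<..t}. g j x \<partial>gauss \<sigma>) = D j t" for j
      unfolding D_def using t cont[of j]
      by (intro set_integral_gauss_Ioc) (auto intro: borel_measurable_continuous_onI)
    have lo: "ext_threshold n (\<zeta>(i := s)) (i - 1) = ext_threshold n \<zeta> (i - 1)"
      and hi: "ext_threshold n (\<zeta>(i := s)) (i + 1) = ext_threshold n \<zeta> (i + 1)"
      and mid: "ext_threshold n (\<zeta>(i := s)) i = ereal s" for s
      using i by (auto simp: ext_threshold_def)
    \<comment> \<open>\<open>below\<close> and \<open>above\<close> keep the strip between the two
      neighbouring thresholds, so that it touches cells \<open>i\<close> and \<open>i + 1\<close>
      only.\<close>
    have below: "ext_threshold n \<zeta> (i - 1) < ereal x" if "c < x" for x
      using ab(3) by (rule le_less_trans) (use that c in simp)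
    have above: "ereal x \<le> ext_threshold n \<zeta> (i + 1)" if "x \<le> t" for x
      using ab(4) by (rule order_trans[rotated]) (use that t in simp)
    have "cell n (\<zeta>(i := t)) i = cell n (\<zeta>(i := c)) i \<union> {c<..t}"
      unfolding cell_def lo mid using below t by auto
    moreover have "cell n (\<zeta>(i := c)) i \<inter> {c<..t} = {}"
      unfolding cell_def lo mid by auto
    ultimately have Si: "S t i = S c i + D i t"
      unfolding S_def D[symmetric] by (simp add: set_integral_Un si)
    have "cell n (\<zeta>(i := c)) (i + 1) = cell n (\<zeta>(i := t)) (i + 1) \<union> {c<..t}"
      unfolding cell_def hi add_diff_cancel_right' mid using above t by auto
    moreover have "cell n (\<zeta>(i := t)) (i + 1) \<inter> {c<..t} = {}"
      unfolding cell_def hi add_diff_cancel_right' mid by auto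
    ultimately have Si1: "S c (i + 1) = S t (i + 1) + D (i + 1) t"
      unfolding S_def D[symmetric] by (simp add: set_integral_Un si)
    have "S t j = S c j" if "j \<in> {1..n}" "j \<noteq> i" "j \<noteq> i + 1" for j
    proof -
      have "cell n (\<zeta>(i := t)) j = cell n (\<zeta>(i := c)) j"
        using that by (auto simp: cell_def ext_threshold_def)
      then show ?thesis by (simp add: S_def)
    qed
    then have "S t j = S c j + (if j = i then D i t else 0) - (if j = i + 1 then D (i + 1) t else 0)"
      if "j \<in> {1..n}" for j
      using that Si Si1 by (cases "j = i"; cases "j = i + 1") auto
    then have "(\<Sum>j\<in>{1..n}. S t j) = (\<Sum>j\<in>{1..n}. S c j + (if j = i then D i t else 0)
        - (if j = i + 1 then D (i + 1) t else 0))"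
      by (rule sum.cong[OF refl])
    also have "\<dots> = (\<Sum>j\<in>{1..n}. S c j) + D i t - D (i + 1) t"
      using i by (simp only: sum.distrib sum_subtractf sum.delta finite_atLeastAtMost) auto
    finally show ?thesis by simp
  qed
  \<comment> \<open>The fundamental theorem gives the derivative within \<open>{c..b}\<close>; as
    \<open>\<zeta> i\<close> is interior, it is a full derivative.\<close>
  have deriv_D: "(D j has_real_derivative normal_density 0 \<sigma> (\<zeta> i) * g j (\<zeta> i)) (at (\<zeta> i))" for j
  proof -
    have "continuous_on {c..b} (\<lambda>x. normal_density 0 \<sigma> x * g j x)"
      unfolding normal_density_def using \<sigma>
      by (intro continuous_intros continuous_on_subset[OF cont]) auto
    then have "((\<lambda>u. LBINT x=c..u. normal_density 0 \<sigma> x * g j x) has_vector_derivative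
        normal_density 0 \<sigma> (\<zeta> i) * g j (\<zeta> i)) (at (\<zeta> i) within {c..b})"
      using c ab by (intro interval_integral_FTC2) auto
    then show ?thesis
      using c ab unfolding D_def
      by (simp add: at_within_Icc_at has_real_derivative_iff_has_vector_derivative)
  qed
  have "((\<lambda>t. (\<Sum>j\<in>{1..n}. S c j) + D i t - D (i + 1) t) has_real_derivative
      normal_density 0 \<sigma> (\<zeta> i) * g i (\<zeta> i) - normal_density 0 \<sigma> (\<zeta> i) * g (i + 1) (\<zeta> i)) (at (\<zeta> i))"
    by (auto intro!: derivative_eq_intros deriv_D)
  from has_field_derivative_transform_within_open[OF this open_greaterThanLessThan _ sum_eq]
  show ?thesis
    using c ab by (simp add: S_def right_diff_distrib)
qed

section \<open>The two stationarity relations\<close>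

text \<open>Moving a level changes neither cells nor weights. Stationarity makes \<open>J\<close>
  contribute nothing, which leaves the derivative of an explicit quadratic with first moment
  \<open>w * centroid\<close>.\<close>

lemma interior_stationary_mmse_deriv:
  assumes "\<sigma> > 0" and st: "interior_stationary k \<sigma> n y \<zeta>" and i: "i \<in> {1..n}"
  shows "((\<lambda>t. mmse (discr n (weight \<sigma> n \<zeta>) (y(i := t)))) has_real_derivative
    - (2 * k\<^sup>2 * weight \<sigma> n \<zeta> i * (y i - centroid \<sigma> n \<zeta> i))) (at (y i))"
proof -
  define rest where "rest = (\<Sum>j\<in>{1..n} - {i}. \<integral>x\<in>cell n \<zeta> j. (x - y j)\<^sup>2 \<partial>gauss \<sigma>)"
  define M1 where "M1 = (\<integral>x\<in>cell n \<zeta> i. x \<partial>gauss \<sigma>)"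
  define M2 where "M2 = (\<integral>x\<in>cell n \<zeta> i. x\<^sup>2 \<partial>gauss \<sigma>)"
  define w where "w = weight \<sigma> n \<zeta> i"
  have "w > 0" and J: "((\<lambda>t. J k \<sigma> n (y(i := t)) \<zeta>) has_real_derivative 0) (at (y i))"
    using st i by (auto simp: interior_stationary_def w_def)
  \<comment> \<open>Positivity of the weight cancels the inverse in \<open>centroid\<close>.\<close>
  then have M1: "M1 = w * centroid \<sigma> n \<zeta> i"
    by (simp add: centroid_def M1_def w_def)
  have "mmse (discr n (weight \<sigma> n \<zeta>) (y(i := t)))
      = J k \<sigma> n (y(i := t)) \<zeta> - k\<^sup>2 * (M2 - 2 * t * M1 + t\<^sup>2 * w + rest)" for t
  proof -
    have "(\<Sum>j\<in>{1..n}. \<integral>x\<in>cell n \<zeta> j. (x - (y(i := t)) j)\<^sup>2 \<partial>gauss \<sigma>)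
        = (\<integral>x\<in>cell n \<zeta> i. (x - t)\<^sup>2 \<partial>gauss \<sigma>) + rest"
      using i by (simp add: sum.remove[of _ i] rest_def)
    also have "\<dots> = M2 - 2 * t * M1 + t\<^sup>2 * w + rest"
      using set_integral_gauss_square[OF assms(1), of "cell n \<zeta> i" t]
      by (simp add: M1_def M2_def w_def weight_def)
    finally show ?thesis by (simp add: J_def)
  qed
  moreover have "((\<lambda>t. J k \<sigma> n (y(i := t)) \<zeta> - k\<^sup>2 * (M2 - 2 * t * M1 + t\<^sup>2 * w + rest))
      has_real_derivative - (2 * k\<^sup>2 * w * (y i - centroid \<sigma> n \<zeta> i))) (at (y i))"
    by (auto intro!: derivative_eq_intros J simp: M1 algebra_simps)
  ultimately show ?thesis by (simp add: w_def)
qed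

text \<open>Envelope argument: the regression \<open>m\<close> of the stationary point, used as an estimator at
  nearby thresholds, gives an upper bound of \<^const>\<open>J\<close> that touches it at \<open>\<zeta> i\<close>, so the bound
  is stationary there as well.\<close>

lemma interior_stationary_threshold:
  assumes \<sigma>: "\<sigma> > 0" and k: "k > 0" and n: "n \<ge> 1"
    and st: "interior_stationary k \<sigma> n y \<zeta>"
    and m: "is_regression (discr n (weight \<sigma> n \<zeta>) y) m" and i: "i \<in> {1..<n}"
  shows "\<zeta> i = (y i + y (i + 1)) / 2
    + (Psi m (y (i + 1)) - Psi m (y i)) / (2 * k\<^sup>2 * (y (i + 1) - y i))"
proof -
  \<comment> \<open>The constant \<open>Psi m (y j)\<close> integrates over cell \<open>j\<close> to
    the weight times itself, so the whole majorant becomes one sum of cell integrals and a single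
    differentiation rule handles it.\<close>
  define g where "g j x = k\<^sup>2 * (x - y j)\<^sup>2 + Psi m (y j)" for j x
  define H where "H t = (\<Sum>j\<in>{1..n}. \<integral>x\<in>cell n (\<zeta>(i := t)) j. g j x \<partial>gauss \<sigma>)" for t
  have mono: "strict_mono_on {1..<n} \<zeta>" and y: "y i < y (i + 1)"
    using st i by (auto simp: interior_stationary_def ordered_def strict_mono_on_def)
  interpret prob_space "gauss \<sigma>" by (rule prob_space_gauss) fact
  have sq: "integrable (gauss \<sigma>) (\<lambda>x. (x - c)\<^sup>2)" for c
    using integrable_gauss_power[OF \<sigma>, of 1] integrable_gauss_power[OF \<sigma>, of 2]
    by (simp add: power2_diff)
  have int_g: "integrable (gauss \<sigma>) (g j)" for j
    unfolding g_def using sq by simp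
  have H_eq: "H t = k\<^sup>2 * (\<Sum>j\<in>{1..n}. \<integral>x\<in>cell n (\<zeta>(i := t)) j. (x - y j)\<^sup>2 \<partial>gauss \<sigma>)
      + (\<Sum>j\<in>{1..n}. weight \<sigma> n (\<zeta>(i := t)) j * Psi m (y j))" for t
  proof -
    have "(\<integral>x\<in>A. g j x \<partial>gauss \<sigma>)
        = k\<^sup>2 * (\<integral>x\<in>A. (x - y j)\<^sup>2 \<partial>gauss \<sigma>) + measure (gauss \<sigma>) A * Psi m (y j)"
      if "A \<in> sets borel" for A j
      unfolding g_def using that
      by (subst set_integral_add) (auto intro!: set_integrable_gauss sq simp: set_lebesgue_integral_def)
    then show ?thesis
      by (simp add: H_def weight_def sum.distrib sum_distrib_left)
  qed
  note sw = sum_weight[OF \<sigma> n]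
  have le: "J k \<sigma> n y (\<zeta>(i := t)) \<le> H t" if "strict_mono_on {1..<n} (\<zeta>(i := t))" for t
    using mmse_discr_le_sum_Psi[OF weight_nonneg sw[OF mono] weight_nonneg sw[OF that] m]
    by (simp add: J_def H_eq)
  have eq: "J k \<sigma> n y (\<zeta>(i := \<zeta> i)) = H (\<zeta> i)"
    using mmse_discr_eq_sum_Psi[OF weight_nonneg sw[OF mono] m] by (simp add: J_def H_eq)
  obtain a b where ab: "a < \<zeta> i" "\<zeta> i < b"
    "\<And>t. a < t \<Longrightarrow> t < b \<Longrightarrow> strict_mono_on {1..<n} (\<zeta>(i := t))"
    using threshold_neighbourhood[OF mono i] by metis
  \<comment> \<open>\<open>H - J\<close> is nonnegative near \<open>\<zeta> i\<close> and zero
    there. At this local minimum its derivative, to which \<open>J\<close> contributes 0, must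
    vanish.\<close>
  have "((\<lambda>t. H t - J k \<sigma> n y (\<zeta>(i := t))) has_real_derivative
      normal_density 0 \<sigma> (\<zeta> i) * (g i (\<zeta> i) - g (i + 1) (\<zeta> i)) - 0) (at (\<zeta> i))"
    unfolding H_def using st i
    by (intro DERIV_diff has_derivative_sum_cell_integrals \<sigma> mono int_g)
       (auto simp: interior_stationary_def g_def intro!: continuous_intros)
  then have "normal_density 0 \<sigma> (\<zeta> i) * (g i (\<zeta> i) - g (i + 1) (\<zeta> i)) - 0 = 0"
  proof (rule DERIV_local_min)
    show "0 < min (\<zeta> i - a) (b - \<zeta> i)" using ab by simp
    show "\<forall>t. \<bar>\<zeta> i - t\<bar> < min (\<zeta> i - a) (b - \<zeta> i) \<longrightarrow>
        H (\<zeta> i) - J k \<sigma> n y (\<zeta>(i := \<zeta> i)) \<le> H t - J k \<sigma> n y (\<zeta>(i := t))"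
    proof (intro allI impI)
      fix t assume "\<bar>\<zeta> i - t\<bar> < min (\<zeta> i - a) (b - \<zeta> i)"
      then have "a < t" "t < b" by linarith+
      with le ab(3) eq show "H (\<zeta> i) - J k \<sigma> n y (\<zeta>(i := \<zeta> i)) \<le> H t - J k \<sigma> n y (\<zeta>(i := t))"
        by fastforce
    qed
  qed
  then have "g i (\<zeta> i) = g (i + 1) (\<zeta> i)"
    using normal_density_pos[OF \<sigma>, of 0 "\<zeta> i"] by simp
  \<comment> \<open>The difference of the two squared distances to \<open>\<zeta> i\<close> has the
    factor \<open>y (i + 1) - y i\<close>, which is positive by the ordering and can be divided
    out.\<close>
  then have "Psi m (y (i + 1)) - Psi m (y i) = k\<^sup>2 * (y (i + 1) - y i) * (2 * \<zeta> i - (y i + y (i + 1)))"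
    by (simp add: g_def power2_eq_square algebra_simps)
  then show ?thesis
    using k y by (simp add: field_simps)
qed

section \<open>Large \<open>k\<close>: the correction to the midpoint\<close>

text \<open>The Lipschitz bound cancels the gap \<open>y (i + 1) - y i\<close> in the denominator
  and leaves \<open>L / (2 * \<kappa>^2)\<close>, however close adjacent levels are. Uniformity over
  configurations matters because a stationary point may move with the parameter.\<close>

lemma Voronoi_correction_vanishes:
  fixes R \<epsilon> :: real
  assumes \<sigma>: "\<sigma> > 0" and n: "n \<ge> 1" and "\<epsilon> > 0"
  shows "\<forall>\<^sub>F \<kappa> in at_top. \<forall>y \<zeta> m. ordered n y \<zeta> \<longrightarrow> (\<forall>i\<in>{1..n}. \<bar>y i\<bar> \<le> R) \<longrightarrow>
    is_regression (discr n (weight \<sigma> n \<zeta>) y) m \<longrightarrow>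
    (\<forall>i\<in>{1..<n}. \<bar>(Psi m (y (i + 1)) - Psi m (y i)) / (2 * \<kappa>\<^sup>2 * (y (i + 1) - y i))\<bar> < \<epsilon>)"
proof -
  obtain L where L: "0 \<le> L"
    "\<And>f x y. f \<in> borel_measurable borel \<Longrightarrow> (\<And>z. \<bar>f z\<bar> \<le> R) \<Longrightarrow> \<bar>x\<bar> \<le> R \<Longrightarrow> \<bar>y\<bar> \<le> R \<Longrightarrow>
      \<bar>Psi f x - Psi f y\<bar> \<le> L * \<bar>x - y\<bar>"
    using Psi_Lipschitz[of R] by blast
  have "\<forall>\<^sub>F \<kappa> in at_top. L / (2 * \<kappa>\<^sup>2) < \<epsilon>"
    \<comment> \<open>Past this point \<open>L < \<epsilon> * \<kappa>\<close>, and
      \<open>\<kappa> > 1\<close> raises the right side to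
      \<open>\<epsilon> * \<kappa>^2\<close>.\<close>
    using eventually_gt_at_top[of "max 1 (L / \<epsilon>)"]
  proof eventually_elim
    case (elim \<kappa>)
    then have "L < \<epsilon> * \<kappa>" "\<epsilon> * \<kappa> * 1 \<le> \<epsilon> * \<kappa> * \<kappa>"
      using \<open>\<epsilon> > 0\<close> by (simp_all add: field_simps)
    moreover have "0 < \<epsilon> * \<kappa>\<^sup>2"
      using elim \<open>\<epsilon> > 0\<close> by simp
    ultimately show ?case
      using elim by (simp add: divide_simps power2_eq_square algebra_simps)
  qed
  moreover have "\<forall>\<^sub>F \<kappa> in at_top. (0::real) < \<kappa>"
    by (rule eventually_gt_at_top)
  ultimately show ?thesis
  proof eventually_elim
    case (elim \<kappa>)
    show ?case
    proof (intro allI impI ballI)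
      fix y \<zeta> m i
      assume ord: "ordered n y \<zeta>" and R: "\<forall>i\<in>{1..n}. \<bar>y i\<bar> \<le> R"
        and m: "is_regression (discr n (weight \<sigma> n \<zeta>) y) m" and i: "i \<in> {1..<n}"
      have mono: "strict_mono_on {1..<n} \<zeta>" and y: "y i < y (i + 1)"
        using ord i by (auto simp: ordered_def strict_mono_on_def)
      obtain f where f: "f \<in> borel_measurable borel" "\<And>z. \<bar>f z\<bar> \<le> R" "\<And>c. Psi m c = Psi f c"
        using regression_bounded_version[OF weight_nonneg sum_weight[OF \<sigma> n mono] _ m, of R] R by metis
      have "\<bar>Psi m (y (i + 1)) - Psi m (y i)\<bar> \<le> L * \<bar>y (i + 1) - y i\<bar>"
        unfolding f(3) using i R by (intro L(2) f) auto
      then have "\<bar>(Psi m (y (i + 1)) - Psi m (y i)) / (2 * \<kappa>\<^sup>2 * (y (i + 1) - y i))\<bar> \<le> L / (2 * \<kappa>\<^sup>2)"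
        using y elim by (simp add: abs_divide abs_mult divide_simps mult.commute mult.left_commute)
      with elim show "\<bar>(Psi m (y (i + 1)) - Psi m (y i)) / (2 * \<kappa>\<^sup>2 * (y (i + 1) - y i))\<bar> < \<epsilon>"
        by linarith
    qed
  qed
qed

text \<open>\<open>deriv\<close> denotes some value even where no derivative exists, so
  differentiability is asserted alongside the first relation. The last conjunct states the limit
  uniformly over ordered configurations with levels in \<open>[-R, R]\<close>.\<close>

theorem proposition4p8:
  fixes \<sigma> k :: real and n :: nat and y \<zeta> :: "nat \<Rightarrow> real" and m :: "real \<Rightarrow> real"
  assumes "\<sigma> > 0" and "k > 0" and "n \<ge> 1"
    and "interior_stationary k \<sigma> n y \<zeta>"
    and "is_regression (discr n (weight \<sigma> n \<zeta>) y) m"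
  shows
    "(\<forall>i\<in>{1..n}.
        (\<lambda>t. mmse (discr n (weight \<sigma> n \<zeta>) (y(i := t)))) differentiable (at (y i)) \<and>
        2 * k\<^sup>2 * weight \<sigma> n \<zeta> i * (y i - centroid \<sigma> n \<zeta> i)
          + deriv (\<lambda>t. mmse (discr n (weight \<sigma> n \<zeta>) (y(i := t)))) (y i) = 0) \<and>
     (\<forall>i\<in>{1..<n}.
        \<zeta> i = (y i + y (i + 1)) / 2
          + (Psi m (y (i + 1)) - Psi m (y i)) / (2 * k\<^sup>2 * (y (i + 1) - y i))) \<and>
     (\<forall>R. \<forall>\<epsilon>>0. \<forall>\<^sub>F \<kappa> in at_top. \<forall>y' \<zeta>' m'.
        ordered n y' \<zeta>' \<longrightarrow> (\<forall>i\<in>{1..n}. \<bar>y' i\<bar> \<le> R) \<longrightarrow>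
        is_regression (discr n (weight \<sigma> n \<zeta>') y') m' \<longrightarrow>
        (\<forall>i\<in>{1..<n}.
          \<bar>(Psi m' (y' (i + 1)) - Psi m' (y' i)) / (2 * \<kappa>\<^sup>2 * (y' (i + 1) - y' i))\<bar> < \<epsilon>))"
proof (intro conjI ballI allI impI)
  fix i assume i: "i \<in> {1..n}"
  note D = interior_stationary_mmse_deriv[OF assms(1,4) i]
  show "(\<lambda>t. mmse (discr n (weight \<sigma> n \<zeta>) (y(i := t)))) differentiable (at (y i))"
    using D by (auto simp: real_differentiable_def)
  show "2 * k\<^sup>2 * weight \<sigma> n \<zeta> i * (y i - centroid \<sigma> n \<zeta> i)
      + deriv (\<lambda>t. mmse (discr n (weight \<sigma> n \<zeta>) (y(i := t)))) (y i) = 0"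
    using DERIV_imp_deriv[OF D] by simp
next
  fix i assume "i \<in> {1..<n}"
  then show "\<zeta> i = (y i + y (i + 1)) / 2
      + (Psi m (y (i + 1)) - Psi m (y i)) / (2 * k\<^sup>2 * (y (i + 1) - y i))"
    by (rule interior_stationary_threshold[OF assms])
qed (rule Voronoi_correction_vanishes[OF assms(1,3)])

end
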